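(* Let $k$ and $m$ be positive integers with $m \geq k+1$. If $\mathcal A$ is an intersecting collection of $k$-multisets of $[m]$, then $$|\mathcal A| \leq \binom{m+k-2}{k-1}.$$ Moreover, if $m > k+1$, then equality holds if and only if there is an element $x \in [m]$ such that $\mathcal A$ is the collection of all $k$-multisets of $[m]$ that contain $x$.
   Context: $[m] = \{1,\dots,m\}$. A multiset is a generalization of a set in which an element may appear more than once (order is irrelevant); its cardinality is the total number of elements counted with repetitions. A $k$-multiset of (or from) $[m]$ is a multiset of cardinality $k$ all of whose elements belong to $[m]$. Two multisets are intersecting if they have at least one element in common. A collection (set) of $k$-multisets is intersecting if every pair of multisets in the collection is intersecting. *)

theory Defs
  imports Complex_Main "HOL-Library.Multiset"
begin

definition k_multisets :: "nat \<Rightarrow> nat \<Rightarrow> nat multiset set" where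
  "k_multisets k m = {M. size M = k \<and> set_mset M \<subseteq> {1..m}}"

definition intersecting :: "'a multiset \<Rightarrow> 'a multiset \<Rightarrow> bool" where
  "intersecting M N \<longleftrightarrow> (\<exists>x. x \<in># M \<and> x \<in># N)"

(* "pairwise" ranges over distinct members only; a nonempty multiset intersects itself anyway. *)
definition intersecting_collection :: "'a multiset set \<Rightarrow> bool" where
  "intersecting_collection \<A> \<longleftrightarrow> pairwise intersecting \<A>"

end

theory Submission
  imports Defs "HOL-Combinatorics.Multiset_Permutations" "HOL-Combinatorics.Transposition"
begin

text \<open>
  There is a bijection \<open>f\<close> from the \<open>k\<close>-subsets of \<open>[m + k - 1]\<close> to the \<open>k\<close>-multisets of \<open>[m]\<close> such
  that the support of \<open>f B\<close> is \<open>B \<inter> [m]\<close>. The preimage of an intersecting collection is an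
  intersecting family of sets, so the bound is that of Erdos, Ko and Rado; \<open>m > k + 1\<close> says that
  the ground set has more than \<open>2 k\<close> elements, in which case the extremal families of sets are the
  stars. The centre of the star lies in \<open>[m]\<close>, for two sets meeting only in a point outside \<open>[m]\<close>
  correspond to disjoint multisets.

  The Erdos-Ko-Rado theorem is proved by Katona's cycle method: at most \<open>k\<close> arcs of each cyclic
  order of the ground set belong to the family. In the case of equality, every cyclic order has
  exactly \<open>k\<close> such arcs; in one of them they are the arcs through a common point \<open>x\<close>, and this
  remains so under all swaps of neighbours other than \<open>x\<close>, hence under all rearrangements of
  the other points.
\<close>

section \<open>Intersecting arcs of a cycle\<close>

text \<open>
  Starting points of pairwise intersecting arcs of length \<open>k\<close> on a cycle of length \<open>n\<close>: the cyclic
  distance is less than \<open>k\<close>.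
\<close>

definition cyclically_close :: "nat \<Rightarrow> nat \<Rightarrow> nat set \<Rightarrow> bool" where
  "cyclically_close n k S \<longleftrightarrow>
     S \<subseteq> {..<n} \<and> (\<forall>i\<in>S. \<forall>j\<in>S. i \<le> j \<longrightarrow> j - i < k \<or> n - k < j - i)"

text \<open>
  Relative to a base point \<open>a\<close>, the starting points \<open>a + i\<close> and \<open>a + n - k + i\<close> exclude each other,
  so identifying them is injective on a close set.
\<close>

definition fold_position :: "nat \<Rightarrow> nat \<Rightarrow> nat \<Rightarrow> nat \<Rightarrow> nat" where
  "fold_position n k a j = (if j - a < k then j - a else j - a - (n - k))"

text \<open>Distinct points with equal images would lie exactly \<open>n - k\<close> apart, a
  distance that closeness excludes because \<open>k \<le> n - k\<close>. The base
  \<open>Min S\<close> keeps \<open>j - a\<close> from being truncated.\<close>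

lemma fold_position:
  assumes S: "cyclically_close n k S" "S \<noteq> {}" and nk: "2 * k \<le> n"
  shows "inj_on (fold_position n k (Min S)) S" "fold_position n k (Min S) ` S \<subseteq> {..<k}"
proof -
  let ?a = "Min S"
  have fin: "finite S"
    using S(1) unfolding cyclically_close_def by (meson finite_lessThan finite_subset)
  have a: "?a \<in> S" and le: "\<And>j. j \<in> S \<Longrightarrow> ?a \<le> j"
    using fin S(2) by auto
  have lt: "\<And>j. j \<in> S \<Longrightarrow> j < n" 
    and close: "\<And>i j. \<lbrakk>i \<in> S; j \<in> S; i \<le> j\<rbrakk> \<Longrightarrow> j - i < k \<or> n - k < j - i"
    using S(1) unfolding cyclically_close_def by auto
  show "inj_on (fold_position n k ?a) S"
  proof (rule inj_onI)
    fix i j assume ij: "i \<in> S" "j \<in> S" and eq: "fold_position n k ?a i = fold_position n k ?a j"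
    show "i = j"
      using eq close[OF a ij(1) le[OF ij(1)]] close[OF a ij(2) le[OF ij(2)]]
        close[OF ij] close[OF ij(2,1)] le[OF ij(1)] le[OF ij(2)] nk
      unfolding fold_position_def by (cases "i \<le> j") (simp split: if_splits; linarith)+
  qed
  show "fold_position n k ?a ` S \<subseteq> {..<k}"
  proof
    fix t assume "t \<in> fold_position n k ?a ` S"
    then obtain j where j: "j \<in> S" "t = fold_position n k ?a j" by auto
    then show "t \<in> {..<k}"
      using close[OF a j(1) le[OF j(1)]] lt[OF j(1)] nk unfolding fold_position_def by auto
  qed
qed

lemma cyclically_close_card_le:
  assumes "cyclically_close n k S" and "2 * k \<le> n"
  shows "card S \<le> k"
proof (cases "S = {}")
  case False
  then show ?thesis
    using card_inj_on_le[OF fold_position[OF assms(1) False assms(2)]] by simp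
qed simp

text \<open>These are the starting points of the arcs through position 0: an arc from
  \<open>i > 0\<close> wraps around to 0 iff \<open>i + k > n\<close>.\<close>

lemma card_window:
  assumes "1 \<le> k" "k \<le> n"
  shows "card {i. i < n \<and> (i = 0 \<or> n - k < i)} = k"
proof -
  have "{i. i < n \<and> (i = 0 \<or> n - k < i)} = insert 0 {n - k<..<n}"
    using assms by auto
  then show ?thesis using assms by simp
qed

text \<open>Equality makes \<open>fold_position\<close> onto \<open>{..<k}\<close>, so each pair
  \<open>a + i\<close>, \<open>a + n - k + i\<close> is hit. The lower choices form an initial
  segment ending at \<open>s = a + t\<close>; the upper ones continue it backwards around the cycle,
  so \<open>s\<close> is the common point of the arcs.\<close>

lemma cyclically_close_window:
  assumes S: "cyclically_close n k S" "card S = k" and k: "1 \<le> k" and nk: "2 * k < n"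
  obtains s where "s < n" "\<And>i. i < n \<Longrightarrow> (i + s) mod n \<in> S \<longleftrightarrow> i = 0 \<or> n - k < i"
proof -
  have ne: "S \<noteq> {}" using S(2) k by auto
  have fin: "finite S" using S(2) k card.infinite by fastforce
  have lt: "\<And>j. j \<in> S \<Longrightarrow> j < n" 
    and close: "\<And>i j. \<lbrakk>i \<in> S; j \<in> S; i \<le> j\<rbrakk> \<Longrightarrow> j - i < k \<or> n - k < j - i"
    using S(1) unfolding cyclically_close_def by auto
  define a where "a = Min S"
  have a: "a \<in> S" using fin ne a_def by auto
  have le: "\<And>j. j \<in> S \<Longrightarrow> a \<le> j" using fin a_def by auto
  have nk': "2 * k \<le> n" using nk by simp
  have "card (fold_position n k a ` S) = k"
    using card_image[OF fold_position(1)[OF S(1) ne nk']] S(2) a_def by simp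
  then have img: "fold_position n k a ` S = {..<k}"
    using fold_position(2)[OF S(1) ne nk'] a_def by (simp add: card_subset_eq)
  have choice: "a + i \<in> S \<or> a + n - k + i \<in> S" if i: "i < k" for i
  proof -
    have "i \<in> fold_position n k a ` S" using img i by simp
    then obtain j where "j \<in> S" "fold_position n k a j = i" by auto
    moreover have "j = a + i \<or> j = a + n - k + i"
      using calculation i le[of j] close[OF a, of j] nk
      unfolding fold_position_def by (simp split: if_splits; linarith)
    ultimately show ?thesis by auto
  qed
  \<comment> \<open>Otherwise the upper partner of \<open>a + i\<close> lies
    \<open>n - k - 1\<close> beyond \<open>a + Suc i\<close>, which is a forbidden distance thanks
    to the strict bound \<open>2 * k < n\<close>.\<close>
  have step: "a + i \<in> S" if "a + Suc i \<in> S" "i < k" for i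
  proof (rule ccontr)
    assume "a + i \<notin> S"
    then have "a + n - k + i \<in> S" using choice that by blast
    moreover have "a + Suc i \<le> a + n - k + i" "a + n - k + i - (a + Suc i) = n - Suc k"
      "k \<le> n - Suc k" using nk by linarith+
    ultimately show False using close[OF that(1), of "a + n - k + i"] k nk by simp
  qed
  define t where "t = (GREATEST i. i < k \<and> a + i \<in> S)"
  have t: "t < k \<and> a + t \<in> S"
    unfolding t_def by (rule GreatestI_nat[where k = 0 and b = k]) (use a k in auto)
  have t_max: "i \<le> t" if "i < k" "a + i \<in> S" for i
    unfolding t_def by (rule Greatest_le_nat[where b = k]) (use that in auto)
  have low: "a + t - q \<in> S" if "q \<le> t" for q
    using that
  proof (induction q)
    case 0 then show ?case using t by simp
  next
    case (Suc q)
    then have "a + Suc (t - Suc q) \<in> S" by (simp add: Suc_diff_Suc)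
    then have "a + (t - Suc q) \<in> S" using step[of "t - Suc q"] Suc.prems t by linarith
    then show ?case using Suc.prems by simp
  qed
  define s where "s = a + t"
  have s: "s < n" using t lt s_def by blast
  let ?W = "{i. i < n \<and> (i = 0 \<or> n - k < i)}"
  have sub: "(\<lambda>i. (i + s) mod n) ` ?W \<subseteq> S"
  proof clarify
    fix i assume i: "i < n" "i = 0 \<or> n - k < i"
    define q where "q = n - i"
    show "(i + s) mod n \<in> S"
    proof (cases "i = 0")
      case True then show ?thesis using t s s_def by simp
    next
      case False
      then have q: "1 \<le> q" "q < k" "i = n - q" using i q_def by auto
      show ?thesis
      proof (cases "q \<le> t")
        case True
        then have "i + s = n + ((a + t) - q)" using q(2,3) nk s_def by linarith
        then show ?thesis using low[OF True] lt by simp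
      next
        case False
        \<comment> \<open>Here \<open>t < t + k - q < k\<close>, so maximality of \<open>t\<close>
          forces the upper partner, which is \<open>i + s\<close> itself.\<close>
        then have "a + (t + k - q) \<notin> S" using t_max[of "t + k - q"] q by fastforce
        then have "a + n - k + (t + k - q) \<in> S" using choice[of "t + k - q"] q False by auto
        moreover have "a + n - k + (t + k - q) = i + s" using q i nk s_def False by linarith
        ultimately show ?thesis using lt by simp
      qed
    qed
  qed
  have inj: "inj_on (\<lambda>i. (i + s) mod n) {..<n}"
  proof (rule inj_onI)
    fix i j assume "i \<in> {..<n}" "j \<in> {..<n}" "(i + s) mod n = (j + s) mod n"
    then show "i = j" using s by (auto simp: mod_if split: if_splits)
  qed
  have "card ((\<lambda>i. (i + s) mod n) ` ?W) = k"
    using card_window[OF k] nk by (subst card_image) (auto intro: inj_on_subset[OF inj])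
  then have eq: "(\<lambda>i. (i + s) mod n) ` ?W = S"
    using card_subset_eq[OF fin sub] S(2) by simp
  show thesis
  proof
    show "s < n" by (rule s)
    fix i assume i: "i < n"
    show "(i + s) mod n \<in> S \<longleftrightarrow> i = 0 \<or> n - k < i"
      unfolding eq[symmetric] using inj i by (auto dest: inj_onD)
  qed
qed

section \<open>Arcs of a cyclic order: disjointness and neighbour swaps\<close>

definition arc :: "nat \<Rightarrow> 'a list \<Rightarrow> nat \<Rightarrow> 'a set" where
  "arc k xs i = set (take k (rotate i xs))"

definition arcs_in :: "nat \<Rightarrow> 'a set set \<Rightarrow> 'a list \<Rightarrow> nat set" where
  "arcs_in k F xs = {i. i < length xs \<and> arc k xs i \<in> F}"

lemma arc_conv_nth:
  assumes "k \<le> length xs"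
  shows "arc k xs i = (!) xs ` (\<lambda>t. (i + t) mod length xs) ` {..<k}"
proof -
  have "arc k xs i = (!) (rotate i xs) ` {0..<k}"
    unfolding arc_def using assms by (simp add: nth_image)
  also have "\<dots> = (\<lambda>t. xs ! ((i + t) mod length xs)) ` {0..<k}"
    using assms by (intro image_cong) (auto simp: nth_rotate)
  finally show ?thesis by (simp add: image_image atLeast0LessThan)
qed

lemma arc_rotate: "arc k (rotate s xs) i = arc k xs ((i + s) mod length xs)"
  unfolding arc_def by (metis rotate_conv_mod rotate_rotate)

text \<open>For \<open>s, t < k\<close> the difference of \<open>j + t\<close> and
  \<open>i + s\<close> lies between 1 and \<open>length xs - 1\<close>, so the positions never agree
  modulo the length.\<close>

lemma arc_disjoint:
  assumes "distinct xs" "i \<le> j" "j < length xs" "k \<le> j - i" "j - i \<le> length xs - k" "k \<le> length xs"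
  shows "arc k xs i \<inter> arc k xs j = {}"
proof -
  have "(i + s) mod length xs \<noteq> (j + t) mod length xs" if "s < k" "t < k" for s t
  proof -
    let ?n = "length xs"
    have "i + s < 2 * ?n" "j + t < 2 * ?n" using assms that by linarith+
    then have "(i + s) mod ?n = (if i + s < ?n then i + s else i + s - ?n)"
      "(j + t) mod ?n = (if j + t < ?n then j + t else j + t - ?n)"
      by (simp_all add: mod_if)
    then show ?thesis using assms(2-6) that by (simp split: if_splits; linarith)
  qed
  moreover have "0 < length xs" using assms by linarith
  ultimately show ?thesis
    using assms(1) unfolding arc_conv_nth[OF assms(6)]
    by (auto simp: nth_eq_iff_index_eq)
qed

lemma cyclically_close_arcs_in:
  assumes "distinct xs" "1 \<le> k" "2 * k \<le> length xs"
    and F: "pairwise (\<lambda>A B. A \<inter> B \<noteq> {}) F"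
  shows "cyclically_close (length xs) k (arcs_in k F xs)"
  unfolding cyclically_close_def
proof (intro conjI ballI impI)
  show "arcs_in k F xs \<subseteq> {..<length xs}" by (auto simp: arcs_in_def)
  fix i j assume ij: "i \<in> arcs_in k F xs" "j \<in> arcs_in k F xs" "i \<le> j"
  show "j - i < k \<or> length xs - k < j - i"
  proof (rule ccontr)
    assume "\<not> ?thesis"
    then have dis: "arc k xs i \<inter> arc k xs j = {}"
      using assms ij by (intro arc_disjoint) (auto simp: arcs_in_def)
    \<comment> \<open>\<open>pairwise\<close> speaks of distinct sets only; disjoint arcs are
      distinct because they are nonempty.\<close>
    have "arc k xs i \<noteq> {}" using assms unfolding arc_def by auto
    then have "arc k xs i \<noteq> arc k xs j" using dis by auto
    then show False using F dis ij unfolding pairwise_def arcs_in_def by auto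
  qed
qed

text \<open>An arc changes only if it contains exactly one of the swapped positions
  \<open>u - 1\<close> and \<open>u\<close>, that is, if it starts at \<open>u\<close> or ends at
  \<open>u - 1\<close>.\<close>

lemma arc_swap:
  fixes as bs :: "'a list" and a b :: 'a
  defines "xs \<equiv> as @ a # b # bs" and "ys \<equiv> as @ b # a # bs" and "u \<equiv> Suc (length as)"
  assumes k: "1 \<le> k" "k \<le> length xs" and i: "i < length xs" "i \<noteq> u" "(i + k) mod length xs \<noteq> u"
  shows "arc k ys i = arc k xs i"
proof -
  let ?n = "length xs" and ?j = "length as"
  let ?\<tau> = "transpose ?j u"
  let ?I = "(\<lambda>t. (i + t) mod ?n) ` {..<k}"
  have len: "length ys = ?n" "u < ?n" by (auto simp: xs_def ys_def u_def)
  have nth: "ys ! p = xs ! ?\<tau> p" for p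
    unfolding xs_def ys_def u_def by (auto simp: transpose_def nth_append nth_Cons' )
  have iff: "?j \<in> ?I \<longleftrightarrow> u \<in> ?I"
  proof
    assume "?j \<in> ?I"
    then obtain t where t: "t < k" "?j = (i + t) mod ?n" by auto
    then have *: "(i + Suc t) mod ?n = u"
      using len(2) unfolding u_def by (simp add: mod_Suc)
    then have "Suc t \<noteq> k" using i by auto
    then show "u \<in> ?I" using * t by (intro image_eqI[of _ _ "Suc t"]) auto
  next
    assume "u \<in> ?I"
    then obtain t where t: "t < k" "u = (i + t) mod ?n" by auto
    then have "t \<noteq> 0" using i by (intro notI) simp
    then obtain t' where t': "t = Suc t'" using not0_implies_Suc by blast
    have "?j = (i + t') mod ?n"
      using t unfolding t' u_def by (simp add: mod_Suc split: if_splits)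
    then show "?j \<in> ?I" using t t' by auto
  qed
  have "?\<tau> ` ?I = ?I"
    using iff by (metis transpose_image_eq)
  moreover have "arc k ys i = (!) xs ` ?\<tau> ` ?I"
    using arc_conv_nth[of k ys i] k len(1) nth by (simp add: image_image)
  ultimately show ?thesis using arc_conv_nth[OF k(2), of i] by simp
qed

text \<open>
  If swapping two neighbours in a cyclic order changed the family of arcs that are hit, it would
  exchange one of the two affected arcs for the other. These start at \<open>u\<close> and \<open>v = u - k\<close>; the
  newly hit one is disjoint from the old neighbour of the lost one, their starting points being
  \<open>k + 1 \<le> n - k\<close> apart.
\<close>

lemma cyclically_close_swap_window:
  assumes k: "1 \<le> k" and nk: "2 * k < n"
    and S: "S = {i. i < n \<and> (i = 0 \<or> n - k < i)}"
    and S': "cyclically_close n k S'" "card S' = k"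
    and u: "2 \<le> u" "u < n" and v: "v < n" "(v + k) mod n = u"
    and agree: "\<And>i. \<lbrakk>i < n; i \<noteq> u; i \<noteq> v\<rbrakk> \<Longrightarrow> i \<in> S' \<longleftrightarrow> i \<in> S"
  shows "S' = S"
proof (rule ccontr)
  assume ne: "S' \<noteq> S"
  have sub: "S' \<subseteq> {..<n}"
    and close: "\<And>i j. \<lbrakk>i \<in> S'; j \<in> S'; i \<le> j; k \<le> j - i; j - i \<le> n - k\<rbrakk> \<Longrightarrow> False"
    using S'(1) unfolding cyclically_close_def by (blast, meson leD)
  have fin: "finite S'" using sub finite_subset by blast
  have finS: "finite S" using S by simp
  have cardS: "card S = k" using card_window[OF k, of n] nk S by simp
  have "v \<noteq> u" using v nk k by (auto simp: mod_if split: if_splits)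
  have nsub: "\<not> S' \<subseteq> S" "\<not> S \<subseteq> S'"
    using ne card_subset_eq[OF finS, of S'] card_subset_eq[OF fin, of S] S'(2) cardS by auto
  have "S \<subseteq> {..<n}" using S by auto
  with nsub agree sub have "u \<in> S \<and> u \<notin> S' \<and> v \<in> S' \<and> v \<notin> S \<or> v \<in> S \<and> v \<notin> S' \<and> u \<in> S' \<and> u \<notin> S"
    by blast
  then show False
  proof (elim disjE conjE)
    assume h: "u \<in> S" "v \<in> S'"
    then have vu: "v + k = u" using S u v nk by (auto simp: mod_if split: if_splits)
    show False
    proof (cases "Suc u < n")
      case True
      then have "Suc u \<in> S'" using agree[of "Suc u"] h S u vu by auto
      moreover have "Suc u - v = Suc k" "Suc k \<le> n - k" "v \<le> Suc u" using vu nk by linarith+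
      ultimately show False using close[OF h(2), of "Suc u"] by simp
    next
      case False
      \<comment> \<open>Now \<open>u = n - 1\<close>, whose cyclic successor is 0.\<close>
      then have "0 \<in> S'" using agree[of 0] S u vu nk by auto
      moreover have "v = n - k - 1" "k \<le> n - k - 1" "v \<le> n - k" using vu False u nk by linarith+
      ultimately show False using close[OF _ h(2), of 0] by simp
    qed
  next
    assume h: "v \<in> S" "u \<in> S'"
    show False
    proof (cases "v = 0")
      case True
      then have "u = k" using v nk by simp
      then have "n - 1 \<in> S'" using agree[of "n - 1"] S True nk u by auto
      moreover have "k \<le> n - 1" "k \<le> n - 1 - k" "n - 1 - k \<le> n - k" using nk by linarith+
      ultimately show False using close[OF h(2), of "n - 1"] \<open>u = k\<close> by simp
    next
      case False
      then have vu: "v + k = n + u" using h S v nk by (auto simp: mod_if split: if_splits)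
      \<comment> \<open>\<open>v - 1 = n - k + (u - 1)\<close> is still in the window because
        \<open>2 \<le> u\<close>; for \<open>u = 1\<close> the whole window could shift by
        one.\<close>
      then have "v - 1 \<in> S'" using agree[of "v - 1"] S nk u v \<open>v \<noteq> u\<close> by auto
      moreover have "v - 1 - u = n - k - 1" "u \<le> v - 1" "k \<le> n - k - 1" "n - k - 1 \<le> n - k"
        using vu nk v by linarith+
      ultimately show False using close[OF h(2), of "v - 1"] by simp
    qed
  qed
qed

text \<open>Bubble sort: neighbour swaps bring the head of the target to the front, and induction
  treats the tail, with \<open>P\<close> restricted to lists starting with that head.\<close>

lemma swap_invariant_imp_mset_invariant:
  assumes "mset xs = mset ys" "P xs"
    and "\<And>as a b bs. \<lbrakk>mset (as @ a # b # bs) = mset ys; P (as @ a # b # bs)\<rbrakk> \<Longrightarrow> P (as @ b # a # bs)"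
  shows "P ys"
  using assms
proof (induction ys arbitrary: xs P)
  case Nil
  then show ?case by simp
next
  case (Cons y ys)
  have "y \<in> set xs" using Cons.prems(1) by (metis list.set_intros(1) set_mset_mset)
  then obtain as bs where xs: "xs = as @ y # bs" by (meson split_list)
  have "P (y # as @ bs)"
    using Cons.prems(1,2) unfolding xs
  proof (induction as arbitrary: bs rule: rev_induct)
    case (snoc a as)
    have "P (as @ y # a # bs)"
      using snoc.prems Cons.prems(3)[of as a y bs] by simp
    then show ?case using snoc.IH[of "a # bs"] snoc.prems by simp
  qed simp
  then show ?case
    using Cons.IH[of "as @ bs" "\<lambda>zs. P (y # zs)"] Cons.prems(1,3)[unfolded xs]
      Cons.prems(3)[of "y # _"] by simp
qed

section \<open>The Erdos-Ko-Rado theorem with uniqueness\<close>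

lemma card_subsets_containing:
  assumes V: "finite V" "x \<in> V" and k: "1 \<le> k"
  shows "card {B. B \<subseteq> V \<and> card B = k \<and> x \<in> B} = (card V - 1) choose (k - 1)"
proof -
  let ?C = "{C. C \<subseteq> V - {x} \<and> card C = k - 1}"
  have "{B. B \<subseteq> V \<and> card B = k \<and> x \<in> B} = insert x ` ?C"
  proof (intro equalityI subsetI)
    fix B assume "B \<in> {B. B \<subseteq> V \<and> card B = k \<and> x \<in> B}"
    then show "B \<in> insert x ` ?C"
      using V by (intro image_eqI[of _ _ "B - {x}"]) (auto simp: finite_subset card_Diff_singleton)
  next
    fix B assume "B \<in> insert x ` ?C"
    then obtain C where C: "B = insert x C" "C \<subseteq> V - {x}" "card C = k - 1" by auto
    moreover have "finite C" "x \<notin> C" using C(2) V(1) finite_subset by auto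
    ultimately show "B \<in> {B. B \<subseteq> V \<and> card B = k \<and> x \<in> B}" using V(2) k by auto
  qed
  moreover have "inj_on (insert x) ?C" by (rule inj_onI) blast
  ultimately show ?thesis using V by (simp add: card_image n_subsets card_Diff_singleton)
qed

lemma card_permutations_with_prefix_set:
  assumes V: "finite V" and B: "B \<subseteq> V"
  shows "card {xs \<in> permutations_of_set V. set (take (card B) xs) = B}
           = fact (card B) * fact (card V - card B)"
proof -
  let ?L = "{xs \<in> permutations_of_set V. set (take (card B) xs) = B}"
  let ?R = "permutations_of_set B \<times> permutations_of_set (V - B)"
  have fB: "finite B" using assms finite_subset by blast
  have len: "length ys = card B" if "ys \<in> permutations_of_set B" for ys :: "'a list"
    using that by (rule length_finite_permutations_of_set)
  have "bij_betw (\<lambda>(ys, zs). ys @ zs) ?R ?L"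
  proof (rule bij_betwI[where g = "\<lambda>xs. (take (card B) xs, drop (card B) xs)"])
    show "(\<lambda>(ys, zs). ys @ zs) \<in> ?R \<rightarrow> ?L"
      using B len by (auto simp: permutations_of_set_def)
    show "(\<lambda>xs. (take (card B) xs, drop (card B) xs)) \<in> ?L \<rightarrow> ?R"
    proof
      fix xs assume xs: "xs \<in> ?L"
      then have "distinct (take (card B) xs @ drop (card B) xs)"
        "set (take (card B) xs @ drop (card B) xs) = V"
        unfolding append_take_drop_id by (auto dest: permutations_of_setD)
      then show "(take (card B) xs, drop (card B) xs) \<in> ?R"
        using xs unfolding distinct_append set_append by (auto simp: permutations_of_set_def)
    qed
  qed (auto simp: len)
  then have "card ?L = card ?R" by (simp add: bij_betw_same_card)
  also have "\<dots> = fact (card B) * fact (card V - card B)"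
    using V fB B by (simp add: card_cartesian_product card_Diff_subset)
  finally show ?thesis .
qed

lemma bij_betw_rotate_permutations:
  "bij_betw (rotate i) (permutations_of_set V) (permutations_of_set V)"
proof -
  have "inj (rotate i :: 'a list \<Rightarrow> 'a list)"
    unfolding rotate_def by (rule inj_fn[OF inj_rotate1])
  moreover have "rotate i ` permutations_of_set V \<subseteq> permutations_of_set V"
    by (auto simp: permutations_of_set_def)
  ultimately show ?thesis
    by (simp add: bij_betw_def endo_inj_surj inj_on_subset[OF _ subset_UNIV])
qed

text \<open>Pairs of an ordering and a position whose arc lies in \<open>F\<close> are counted
  twice. For a fixed position, rotation permutes the orderings and turns the arc into a
  prefix.\<close>

lemma sum_card_arcs_in:
  assumes V: "finite V" and F: "F \<subseteq> {B. B \<subseteq> V \<and> card B = k}"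
  shows "(\<Sum>xs\<in>permutations_of_set V. card (arcs_in k F xs))
           = card V * (card F * (fact k * fact (card V - k)))"
proof -
  let ?P = "permutations_of_set V"
  have fin: "finite F" using finite_subset[OF F] V by simp
  have arcs: "card {xs \<in> ?P. arc k xs i \<in> F} = card F * (fact k * fact (card V - k))" for i
  proof -
    have "bij_betw (rotate i) {xs \<in> ?P. arc k xs i \<in> F} {xs \<in> ?P. set (take k xs) \<in> F}"
      using bij_betw_rotate_permutations[of i V] unfolding arc_def
      by (auto simp: bij_betw_def intro: inj_on_subset)
    then have "card {xs \<in> ?P. arc k xs i \<in> F} = card {xs \<in> ?P. set (take k xs) \<in> F}"
      by (rule bij_betw_same_card)
    also have "{xs \<in> ?P. set (take k xs) \<in> F} = (\<Union>B\<in>F. {xs \<in> ?P. set (take k xs) = B})"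
      by auto
    also have "card \<dots> = (\<Sum>B\<in>F. card {xs \<in> ?P. set (take k xs) = B})"
      using fin by (intro card_UN_disjoint) auto
    also have "\<dots> = (\<Sum>B\<in>F. fact k * fact (card V - k))"
    proof (intro sum.cong refl)
      fix B assume "B \<in> F"
      then have "B \<subseteq> V" "card B = k" using F by auto
      then show "card {xs \<in> ?P. set (take k xs) = B} = fact k * fact (card V - k)"
        using card_permutations_with_prefix_set[OF V] by auto
    qed
    finally show ?thesis by simp
  qed
  have "(\<Sum>xs\<in>?P. card (arcs_in k F xs)) = (\<Sum>xs\<in>?P. \<Sum>i<card V. of_bool (arc k xs i \<in> F))"
    by (intro sum.cong refl)
      (auto simp: arcs_in_def length_finite_permutations_of_set Int_def lessThan_def)
  also have "\<dots> = (\<Sum>i<card V. \<Sum>xs\<in>?P. of_bool (arc k xs i \<in> F))"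
    by (rule sum.swap)
  also have "\<dots> = (\<Sum>i<card V. card {xs \<in> ?P. arc k xs i \<in> F})"
    by (simp add: Int_def)
  finally show ?thesis by (simp add: arcs)
qed

text \<open>By the double count, a family of the size of a star averages exactly \<open>k\<close>
  arcs per ordering.\<close>

lemma star_count_times_permutations:
  assumes "1 \<le> k" "k \<le> n"
  shows "n * (((n - 1) choose (k - 1)) * (fact k * fact (n - k))) = k * (fact n :: nat)"
proof -
  obtain k' n' where kn: "k = Suc k'" "n = Suc n'"
    using assms by (metis Suc_le_D One_nat_def)
  have "n * ((n - 1) choose (k - 1)) = k * (n choose k)"
    unfolding kn using Suc_times_binomial[of k' n'] by (simp only: diff_Suc_1)
  moreover have "fact k * fact (n - k) * (n choose k) = fact n"
    using binomial_fact_lemma[OF assms(2)] by simp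
  ultimately show ?thesis by (metis mult.assoc mult.commute)
qed

theorem Erdos_Ko_Rado:
  assumes V: "finite V" and k: "1 \<le> k" and n: "2 * k \<le> card V"
    and F: "F \<subseteq> {B. B \<subseteq> V \<and> card B = k}" and int: "pairwise (\<lambda>A B. A \<inter> B \<noteq> {}) F"
  shows "card F \<le> (card V - 1) choose (k - 1)"
    and "\<lbrakk>2 * k < card V; card F = (card V - 1) choose (k - 1)\<rbrakk>
           \<Longrightarrow> \<exists>x\<in>V. F = {B. B \<subseteq> V \<and> card B = k \<and> x \<in> B}"
proof -
  let ?P = "permutations_of_set V" and ?n = "card V"
  let ?c = "fact k * fact (?n - k) :: nat"
  have close: "cyclically_close ?n k (arcs_in k F xs)" if "xs \<in> ?P" for xs
    using cyclically_close_arcs_in[OF _ k _ int, of xs] n that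
    by (simp add: permutations_of_setD length_finite_permutations_of_set)
  then have le: "card (arcs_in k F xs) \<le> k" if "xs \<in> ?P" for xs
    using cyclically_close_card_le n that by blast
  have star: "?n * (((?n - 1) choose (k - 1)) * ?c) = (\<Sum>xs\<in>?P. k)"
    using star_count_times_permutations[OF k, of ?n] n V by simp
  have "?n * (card F * ?c) \<le> ?n * (((?n - 1) choose (k - 1)) * ?c)"
    unfolding star sum_card_arcs_in[OF V F, symmetric] using le by (rule sum_mono)
  then show "card F \<le> (?n - 1) choose (k - 1)"
    using n k by simp
  assume nk: "2 * k < ?n" and eq: "card F = (?n - 1) choose (k - 1)"
  \<comment> \<open>The sums agree and every term is at most \<open>k\<close>, so every ordering
    attains \<open>k\<close>.\<close>
  have card_arcs: "card (arcs_in k F xs) = k" if "xs \<in> ?P" for xs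
  proof (rule sum_mono_inv[where g = "\<lambda>_. k" and I = ?P])
    show "(\<Sum>xs\<in>?P. card (arcs_in k F xs)) = (\<Sum>xs\<in>?P. k)"
      unfolding sum_card_arcs_in[OF V F] star[symmetric] eq by simp
  qed (use le that in auto)
  let ?W = "{i. i < ?n \<and> (i = 0 \<or> ?n - k < i)}"
  obtain xs where xs: "xs \<in> ?P"
    using V permutations_of_set_empty_iff[of V] by blast
  obtain s where s: "\<And>i. i < ?n \<Longrightarrow> (i + s) mod ?n \<in> arcs_in k F xs \<longleftrightarrow> i = 0 \<or> ?n - k < i"
    using cyclically_close_window[OF close[OF xs] card_arcs[OF xs] k nk] by blast
  have len: "length ys = ?n" if "ys \<in> ?P" for ys
    using that by (rule length_finite_permutations_of_set)
  \<comment> \<open>Rotating by \<open>s\<close> puts the common point at the head, where it stays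
    fixed while the tail is rearranged.\<close>
  define ys where "ys = rotate s xs"
  have ys: "ys \<in> ?P"
    using xs bij_betw_rotate_permutations[of s V] unfolding ys_def bij_betw_def by blast
  have "arcs_in k F ys = ?W"
    using s len[OF xs] n k unfolding arcs_in_def ys_def by (auto simp: arc_rotate)
  moreover obtain x zs where xzs: "ys = x # zs"
    using len[OF ys] n k by (cases ys) auto
  ultimately have W: "arcs_in k F (x # zs) = ?W" by simp
  have xV: "x \<in> V" using ys xzs by (auto dest: permutations_of_setD)
  have perm: "x # zs' \<in> ?P" if "mset zs' = mset zs" for zs'
    using ys xzs that
    by (metis mset.simps(2) mset_eq_imp_distinct_iff mset_eq_setD permutations_of_setD permutations_of_setI)
  have all: "arcs_in k F (x # zs') = ?W" if zs': "mset zs' = mset zs" for zs'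
    using zs'[symmetric] W
  proof (rule swap_invariant_imp_mset_invariant)
    fix as a b bs
    let ?us = "x # as @ a # b # bs" and ?vs = "x # as @ b # a # bs"
    assume "mset (as @ a # b # bs) = mset zs'" and Wu: "arcs_in k F ?us = ?W"
    then have us: "?us \<in> ?P" and vs: "?vs \<in> ?P"
      using perm[of "as @ a # b # bs"] perm[of "as @ b # a # bs"] zs' by (simp_all add: add_mset_commute)
    \<comment> \<open>\<open>u\<close> is the position of \<open>b\<close> in \<open>?us\<close>,
      counting \<open>x\<close> as position 0; \<open>v\<close> below is \<open>u - k\<close> modulo
      \<open>card V\<close>, the start of the arc ending just before \<open>u\<close>.\<close>
    define u where "u = Suc (Suc (length as))"
    have u: "2 \<le> u" "u < ?n" using len[OF us] u_def by auto
    define v where "v = (u + (?n - k)) mod ?n"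
    have "(v + k) mod ?n = (u + (?n - k) + k) mod ?n"
      unfolding v_def by (rule mod_add_left_eq)
    then have v: "v < ?n" "(v + k) mod ?n = u"
      unfolding v_def using u nk by simp_all
    have "arcs_in k F ?vs = arcs_in k F ?us"
    proof (rule cyclically_close_swap_window[OF k nk Wu close[OF vs] card_arcs[OF vs] u v])
      fix i assume i: "i < ?n" "i \<noteq> u" "i \<noteq> v"
      have "(i + k) mod ?n \<noteq> u"
      proof
        assume "(i + k) mod ?n = u"
        then have "v = (i + k + (?n - k)) mod ?n"
          unfolding v_def by (metis mod_add_left_eq)
        then show False using i nk by simp
      qed
      moreover have L: "length ((x # as) @ a # b # bs) = ?n" using len[OF us] by simp
      ultimately have "arc k ?vs i = arc k ?us i"
        using arc_swap[of k "x # as" a b bs i, unfolded L] k i(1,2) nk by (simp add: u_def)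
      then show "i \<in> arcs_in k F ?vs \<longleftrightarrow> i \<in> arcs_in k F ?us"
        by (simp add: arcs_in_def)
    qed
    then show "arcs_in k F ?vs = ?W" using Wu by simp
  qed
  \<comment> \<open>A \<open>k\<close>-set \<open>B\<close> containing \<open>x\<close> is the arc
    at position 0 of an ordering that lists \<open>x\<close>, the rest of \<open>B\<close>, then
    \<open>V - B\<close>.\<close>
  have sub: "{B. B \<subseteq> V \<and> card B = k \<and> x \<in> B} \<subseteq> F"
  proof clarify
    fix B assume B: "B \<subseteq> V" "k = card B" "x \<in> B"
    have finB: "finite B" using B V finite_subset by blast
    obtain bs where bs: "set bs = B - {x}" "distinct bs"
      using finite_distinct_list finB by (metis finite_Diff)
    obtain cs where cs: "set cs = V - B" "distinct cs"
      using finite_distinct_list V by (metis finite_Diff)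
    have "distinct (x # zs)" "set (x # zs) = V"
      using ys unfolding xzs permutations_of_set_def by blast+
    then have "distinct zs" "set zs = V - {x}" by auto
    moreover have "distinct (bs @ cs)" "set (bs @ cs) = V - {x}"
      using bs cs B by auto
    ultimately have "set (bs @ cs) = set zs" "distinct (bs @ cs)" "distinct zs" by simp_all
    then have "mset (bs @ cs) = mset zs" by (simp only: set_eq_iff_mset_eq_distinct)
    then have "0 \<in> arcs_in k F (x # bs @ cs)" using all n k by auto
    then have "set (take k (x # bs @ cs)) \<in> F" by (simp add: arcs_in_def arc_def)
    moreover have "length (x # bs) = k"
      using bs B k distinct_card[OF bs(2)] by simp
    then have "take k (x # bs @ cs) = x # bs" by (metis append_Cons append_eq_conv_conj)
    ultimately show "B \<in> F" using bs B by (simp add: insert_absorb)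
  qed
  have "finite F" using finite_subset[OF F] V by simp
  then have "F = {B. B \<subseteq> V \<and> card B = k \<and> x \<in> B}"
    using card_subset_eq[OF _ sub] card_subsets_containing[OF V xV k] eq by simp
  then show "\<exists>x\<in>V. F = {B. B \<subseteq> V \<and> card B = k \<and> x \<in> B}" using xV by blast
qed

section \<open>From multisets to sets\<close>

text \<open>Removing one copy of each element of \<open>A\<close> leaves an arbitrary multiset of
  size \<open>k - card A\<close> over \<open>A\<close>; stars and bars counts these.\<close>

lemma card_multisets_with_support:
  assumes A: "finite A" "A \<noteq> {}" "card A \<le> k"
  shows "card {M. size M = k \<and> set_mset M = A} = (k - 1) choose (k - card A)"
proof -
  have "bij_betw (\<lambda>N. mset_set A + N) (multisets_of_size A (k - card A))
          {M. size M = k \<and> set_mset M = A}"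
  proof (rule bij_betwI[where g = "\<lambda>M. M - mset_set A"])
    show "(\<lambda>M. M - mset_set A) \<in> {M. size M = k \<and> set_mset M = A} \<rightarrow> multisets_of_size A (k - card A)"
      by (auto simp: multisets_of_size_def size_Diff_submset[OF mset_set_set_mset_msubset] dest: in_diffD)
  qed (use A in \<open>auto simp: multisets_of_size_def subset_mset.add_diff_inverse[OF mset_set_set_mset_msubset]\<close>)
  then have "card {M. size M = k \<and> set_mset M = A} = card (multisets_of_size A (k - card A))"
    by (metis bij_betw_same_card)
  also have "\<dots> = (k - 1) choose (k - card A)"
    using A(3) by (simp add: card_multisets_of_size[OF A(1)])
  finally show ?thesis .
qed

lemma card_subsets_with_trace:
  assumes "finite A" "finite D" "A \<inter> D = {}" "card A \<le> k"
  shows "card {B. B \<subseteq> A \<union> D \<and> card B = k \<and> B - D = A} = card D choose (k - card A)"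
proof -
  have "bij_betw (\<lambda>C. A \<union> C) {C. C \<subseteq> D \<and> card C = k - card A}
          {B. B \<subseteq> A \<union> D \<and> card B = k \<and> B - D = A}"
  proof (rule bij_betwI[where g = "\<lambda>B. B - A"])
    show "(\<lambda>C. A \<union> C) \<in> {C. C \<subseteq> D \<and> card C = k - card A}
        \<rightarrow> {B. B \<subseteq> A \<union> D \<and> card B = k \<and> B - D = A}"
    proof
      fix C assume C: "C \<in> {C. C \<subseteq> D \<and> card C = k - card A}"
      then have "card (A \<union> C) = card A + card C"
        using assms by (intro card_Un_disjoint) (auto intro: finite_subset)
      then show "A \<union> C \<in> {B. B \<subseteq> A \<union> D \<and> card B = k \<and> B - D = A}"
        using C assms by auto
    qed
    show "(\<lambda>B. B - A) \<in> {B. B \<subseteq> A \<union> D \<and> card B = k \<and> B - D = A}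
        \<rightarrow> {C. C \<subseteq> D \<and> card C = k - card A}"
      using assms(1) by (auto intro: card_Diff_subset)
  qed (use assms in auto)
  then show ?thesis
    using assms(2) by (simp add: bij_betw_same_card[symmetric] n_subsets)
qed

text \<open>
  For fixed nonempty \<open>A \<subseteq> [m]\<close> of size at most \<open>k\<close>, there are as many \<open>k\<close>-subsets of \<open>[m + k - 1]\<close> with
  trace \<open>A\<close> on \<open>[m]\<close> as \<open>k\<close>-multisets with support \<open>A\<close>, namely \<open>k - 1\<close> choose \<open>k - |A|\<close>.
\<close>

lemma trace_support_bijection:
  assumes k: "1 \<le> k"
  obtains f where
    "bij_betw f {B. B \<subseteq> {1..m + k - 1} \<and> card B = k} (k_multisets k m)"
    "\<And>B. \<lbrakk>B \<subseteq> {1..m + k - 1}; card B = k\<rbrakk> \<Longrightarrow> set_mset (f B) = B \<inter> {1..m}"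
proof -
  let ?V = "{1..m + k - 1}" and ?D = "{m + 1..m + k - 1}"
  define S where "S A = {B. B \<subseteq> A \<union> ?D \<and> card B = k \<and> B - ?D = A}" for A
  define T where "T A = {M :: nat multiset. size M = k \<and> set_mset M = A}" for A
  let ?I = "{A. A \<subseteq> {1..m} \<and> A \<noteq> {} \<and> card A \<le> k}"
  have "\<exists>g. bij_betw g (S A) (T A)" if A: "A \<in> ?I" for A
  proof -
    have fin: "finite A" using A finite_subset by blast
    have "A \<inter> ?D = {}" using A by fastforce
    then have "card (S A) = card ?D choose (k - card A)"
      unfolding S_def using A fin by (intro card_subsets_with_trace) auto
    moreover have "card (T A) = (k - 1) choose (k - card A)"
      unfolding T_def using A fin by (intro card_multisets_with_support) auto
    ultimately have "card (S A) = card (T A)" by simp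
    moreover have "finite (S A)"
      unfolding S_def using fin by simp
    moreover have "finite (T A)"
      using finite_subset[OF _ finite_multisets_of_size[OF fin, of k], of "T A"]
      unfolding T_def multisets_of_size_def by auto
    ultimately show ?thesis by (simp add: finite_same_card_bij)
  qed
  then obtain g where g: "\<And>A. A \<in> ?I \<Longrightarrow> bij_betw (g A) (S A) (T A)" by metis
  \<comment> \<open>The bijections for the single traces are glued; different supports keep their
    images disjoint.\<close>
  define f where "f B = g (B - ?D) B" for B
  have f: "bij_betw f (S A) (T A)" if "A \<in> ?I" for A
    using g[OF that] by (rule bij_betw_cong[THEN iffD1, rotated]) (auto simp: f_def S_def)
  have "disjoint_family_on T ?I" by (auto simp: disjoint_family_on_def T_def)
  from bij_betw_UNION_disjoint[OF this f]
  have bij: "bij_betw f (\<Union>A\<in>?I. S A) (\<Union>A\<in>?I. T A)" .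
  have trace: "B - ?D \<in> ?I" "B \<in> S (B - ?D)" "B - ?D = B \<inter> {1..m}" if B: "B \<subseteq> ?V" "card B = k" for B
  proof -
    have fin: "finite B" using B finite_subset by blast
    \<comment> \<open>\<open>?D\<close> has only \<open>k - 1\<close> elements, so the trace is
      nonempty, as a support must be.\<close>
    have "\<not> B \<subseteq> ?D" using card_mono[of ?D B] B k by auto
    moreover have "card (B - ?D) \<le> k" using card_mono[OF fin, of "B - ?D"] B by auto
    ultimately show "B - ?D \<in> ?I" using B by fastforce
    show "B \<in> S (B - ?D)" using B by (auto simp: S_def)
    show "B - ?D = B \<inter> {1..m}" using B by fastforce
  qed
  have dom: "(\<Union>A\<in>?I. S A) = {B. B \<subseteq> ?V \<and> card B = k}"
  proof (intro equalityI subsetI)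
    fix B assume "B \<in> (\<Union>A\<in>?I. S A)"
    then obtain A where A: "A \<subseteq> {1..m}" "B \<subseteq> A \<union> ?D" "card B = k" by (auto simp: S_def)
    moreover have "{1..m} \<subseteq> ?V" "?D \<subseteq> ?V" using k by auto
    ultimately show "B \<in> {B. B \<subseteq> ?V \<and> card B = k}" by blast
  next
    fix B assume "B \<in> {B. B \<subseteq> ?V \<and> card B = k}"
    then show "B \<in> (\<Union>A\<in>?I. S A)" using trace(1,2)[of B] by blast
  qed
  have ran: "(\<Union>A\<in>?I. T A) = k_multisets k m"
  proof (intro equalityI subsetI)
    fix M assume "M \<in> k_multisets k m"
    then have M: "size M = k" "set_mset M \<subseteq> {1..m}" by (auto simp: k_multisets_def)
    moreover have "card (set_mset M) \<le> size M"
      using size_mset_mono[OF mset_set_set_mset_msubset[of M]] by simp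
    ultimately show "M \<in> (\<Union>A\<in>?I. T A)" using k by (auto simp: T_def)
  qed (auto simp: T_def k_multisets_def)
  show thesis
  proof
    show "bij_betw f {B. B \<subseteq> ?V \<and> card B = k} (k_multisets k m)"
      using bij unfolding dom ran .
    fix B assume B: "B \<subseteq> ?V" "card B = k"
    then have "f B \<in> T (B - ?D)"
      using f[OF trace(1)[OF B]] trace(2)[OF B] by (auto simp: bij_betw_def)
    then show "set_mset (f B) = B \<inter> {1..m}" using trace(3)[OF B] by (simp add: T_def)
  qed
qed

theorem theorem1p2:
  fixes k m :: nat and \<A> :: "nat multiset set"
  assumes "k \<ge> 1" and "m \<ge> 1" and "m \<ge> k + 1"
    and "\<A> \<subseteq> k_multisets k m"
    and "intersecting_collection \<A>"
  shows "card \<A> \<le> (m + k - 2) choose (k - 1) \<and>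
    (m > k + 1 \<longrightarrow>
      (card \<A> = (m + k - 2) choose (k - 1) \<longleftrightarrow>
        (\<exists>x\<in>{1..m}. \<A> = {M \<in> k_multisets k m. x \<in># M})))"
proof -
  let ?V = "{1..m + k - 1}"
  let ?K = "{B. B \<subseteq> ?V \<and> card B = k}"
  obtain f where f: "bij_betw f ?K (k_multisets k m)"
    and supp: "\<And>B. \<lbrakk>B \<subseteq> ?V; card B = k\<rbrakk> \<Longrightarrow> set_mset (f B) = B \<inter> {1..m}"
    using trace_support_bijection[OF assms(1)] by blast
  define F where "F = {B \<in> ?K. f B \<in> \<A>}"
  have inj: "inj_on f ?K" using f by (simp add: bij_betw_def)
  have f_image: "f ` {B \<in> ?K. P (f B)} = {M \<in> k_multisets k m. P M}" for P
    using f unfolding bij_betw_def by (metis Compr_image_eq)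
  have img: "f ` F = \<A>"
    unfolding F_def f_image[of "\<lambda>M. M \<in> \<A>"] using assms(4) by auto
  have star: "{B. B \<subseteq> ?V \<and> card B = k \<and> x \<in> B} = {B \<in> ?K. x \<in># f B}" if "x \<in> {1..m}" for x
    using supp that by auto
  have card: "card F = card \<A>"
    unfolding img[symmetric] using inj by (intro card_image[symmetric]) (auto simp: F_def intro: inj_on_subset)
  have FK: "F \<subseteq> ?K" by (auto simp: F_def)
  have int: "pairwise (\<lambda>A B. A \<inter> B \<noteq> {}) F"
  proof (rule pairwiseI)
    fix A B assume AB: "A \<in> F" "B \<in> F" "A \<noteq> B"
    then have "f A \<noteq> f B" using inj FK by (auto dest: inj_onD)
    then have "intersecting (f A) (f B)"
      using assms(5) AB unfolding intersecting_collection_def pairwise_def F_def by auto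
    then show "A \<inter> B \<noteq> {}"
      using supp AB unfolding intersecting_def F_def by auto
  qed
  have V: "finite ?V" "card ?V - 1 = m + k - 2" "2 * k \<le> card ?V" using assms(3) by auto
  have bound: "card F \<le> (m + k - 2) choose (k - 1)"
    using Erdos_Ko_Rado(1)[OF V(1) assms(1) V(3) FK int] unfolding V(2) .
  have star_card: "card {M \<in> k_multisets k m. x \<in># M} = (m + k - 2) choose (k - 1)"
    if x: "x \<in> {1..m}" for x
  proof -
    have "card {M \<in> k_multisets k m. x \<in># M} = card {B. B \<subseteq> ?V \<and> card B = k \<and> x \<in> B}"
      unfolding f_image[symmetric] star[OF x] using inj by (intro card_image) (auto intro: inj_on_subset)
    also have "\<dots> = (card ?V - 1) choose (k - 1)"
      using x assms(1) by (intro card_subsets_containing[OF V(1)]) auto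
    finally show ?thesis unfolding V(2) .
  qed
  have unique: "\<exists>x\<in>{1..m}. \<A> = {M \<in> k_multisets k m. x \<in># M}"
    if mk: "m > k + 1" and eq: "card F = (m + k - 2) choose (k - 1)"
  proof -
    have "2 * k < card ?V" using mk by simp
    from Erdos_Ko_Rado(2)[OF V(1) assms(1) V(3) FK int this, unfolded V(2), OF eq]
    obtain x where x: "x \<in> ?V" and F: "F = {B. B \<subseteq> ?V \<and> card B = k \<and> x \<in> B}"
      by (rule bexE)
    have xm: "x \<le> m"
    proof (rule ccontr)
      assume "\<not> x \<le> m"
      then have mx: "m < x" by simp
      \<comment> \<open>Outside \<open>{1..k - 1}\<close> and \<open>x\<close> there remain
        \<open>m - 1\<close> points, enough for a second set meeting the first only in
        \<open>x\<close>. As \<open>m < x\<close>, the supports are then disjoint.\<close>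
      have rest: "card (?V - {1..k - 1} - {x}) \<ge> k - 1"
      proof -
        have "?V - {1..k - 1} = {k..m + k - 1}" using assms(1) by auto
        then show ?thesis using x mx mk by (simp add: card_Diff_singleton)
      qed
      obtain D where D: "D \<subseteq> ?V - {1..k - 1} - {x}" "card D = k - 1" "finite D"
        using obtain_subset_with_card_n[OF rest] by blast
      have "insert x {1..k - 1} \<in> F" "insert x D \<in> F"
        using x mx mk D assms(1) unfolding F by (auto simp: card_insert_if)
      then have BC: "f (insert x {1..k - 1}) \<in> \<A>" "f (insert x D) \<in> \<A>"
        "set_mset (f (insert x {1..k - 1})) \<inter> set_mset (f (insert x D)) = {}"
        using supp D mx FK unfolding F_def by auto
      \<comment> \<open>Disjoint supports give distinct multisets once one is nonempty, and
        \<open>pairwise\<close> needs distinct members.\<close>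
      moreover have "f (insert x D) \<noteq> {#}"
        using BC(2) assms(1,4) by (auto simp: k_multisets_def)
      ultimately have "\<not> intersecting (f (insert x {1..k - 1})) (f (insert x D))"
        "f (insert x {1..k - 1}) \<noteq> f (insert x D)"
        unfolding intersecting_def by auto
      then show False
        using assms(5) BC(1,2) unfolding intersecting_collection_def pairwise_def by blast
    qed
    then have xm': "x \<in> {1..m}" using x by simp
    have "\<A> = {M \<in> k_multisets k m. x \<in># M}"
      using img f_image[of "\<lambda>M. x \<in># M"] unfolding F star[OF xm'] by simp
    then show ?thesis using xm' by blast
  qed
  show ?thesis
  proof (intro conjI impI iffI)
    show "card \<A> \<le> (m + k - 2) choose (k - 1)" using bound unfolding card .
  next
    assume "m > k + 1" "card \<A> = (m + k - 2) choose (k - 1)"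
    then show "\<exists>x\<in>{1..m}. \<A> = {M \<in> k_multisets k m. x \<in># M}" using unique unfolding card by blast
  next
    assume "\<exists>x\<in>{1..m}. \<A> = {M \<in> k_multisets k m. x \<in># M}"
    then show "card \<A> = (m + k - 2) choose (k - 1)" using star_card by blast
  qed
qed

end
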